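(* Assume the standing assumptions (A1)–(A6) of the context. Let $\alpha>0$, $\delta>0$ and $y^\delta\in Y$ be fixed, and let $\{\delta_k\}\subset(0,\infty)$ and $\{y^{\delta_k}\}\subset Y$ be sequences with $\delta_k\to\delta$ and $y^{\delta_k}\to y^\delta$ as $k\to\infty$. Write $\Theta=\Theta(\delta,y^\delta)$, $\Theta_k=\Theta(\delta_k,y^{\delta_k})$, $\Psi^\delta_\Theta=\Psi_\Theta(y^\delta)$ and $\Psi^{\delta_k}_{\Theta_k}=\Psi_{\Theta_k}(y^{\delta_k})$. Then every sequence $\{x_k\}\subset X$ with $$x_k\in\operatorname{argmin}_{x\in X}\Big\{\tfrac12\|Kx-y^{\delta_k}\|_2^2+\alpha\|\Delta_{\Psi^{\delta_k}_{\Theta_k}}x\|_1\Big\}\quad\text{for all }k$$ has a converging subsequence $\{x_{k'}\}$ such that $$\lim_{k'}x_{k'}\in\operatorname{argmin}_{x\in X}\Big\{\tfrac12\|Kx-y^{\delta}\|_2^2+\alpha\|\Delta_{\Psi^{\delta}_{\Theta}}x\|_1\Big\}.$$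
   Context: Setting: $X=\mathbb{R}^n$, $Y=\mathbb{R}^m$, $K:X\to Y$ is linear, $y\in Y$ is the exact datum. $P$ is a finite set with $n$ elements, and $X$ is identified with the space $C(P)$ of real functions on $P$; $x(p)$ is the value of $x$ at $p\in P$. Graph Laplacian induced by $x\in X$: fix a distance $\operatorname{dist}$ on $P$, a function $h_{\mathrm d}:\mathbb{R}\to[0,\infty)$ with $h_{\mathrm d}(0)=0$, and a function $h_{\mathrm i}:\mathbb{R}\to[0,\infty)$. Put $w_{\mathrm d}(p,q)=h_{\mathrm d}(\operatorname{dist}(p,q))$ and, for $x\in X$, $w_x(p,q)=w_{\mathrm d}(p,q)\,h_{\mathrm i}(|x(p)-x(q)|)$ (edge weights). Fix also, for each $x\in X$, a strictly positive function $\mu_x:P\to(0,\infty)$ (node measure). The graph Laplacian induced by $x$ is the linear map $\Delta_x:X\to X$, $\Delta_x u(p)=\frac1{\mu_x(p)}\sum_{q\in P}w_x(p,q)(u(p)-u(q))$. Reconstructors: $\{\Psi_\Theta:Y\to X\}$ is a family of (not necessarily linear) maps with parameters $\Theta$ in a subset of some $\mathbb{R}^\ell$; $\Theta=\Theta(\delta,y^\delta)$ is a parameter choice rule, defined for $\delta>0$, $y^\delta\in Y$. Write $\Psi^\delta_\Theta:=\Psi_{\Theta(\delta,y^\delta)}(y^\delta)\in X$. Standing assumptions: (A1) There is $x_{\mathrm{gt}}\in X$ with $Kx_{\mathrm{gt}}=y$. (A2) There is $x_0\in X$ such that $\|\Psi_{\Theta(\delta,y^\delta)}(y^\delta)-x_0\|_2\to0$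 as $\delta\to0$, for noisy data $y^\delta$ with $\|y^\delta-y\|_2\le\delta$ (i.e. along every sequence $\delta_k\to0$, $\|y^{\delta_k}-y\|_2\le\delta_k$). (A3) For fixed $\delta$, $y^\delta$, $\Theta=\Theta(\delta,y^\delta)$, and sequences $\delta_k\to\delta$, $y^{\delta_k}\to y^\delta$, writing $\Theta_k=\Theta(\delta_k,y^{\delta_k})$, one has $\Theta_k\to\Theta$ and $\|\Psi_{\Theta_k}(y^{\delta_k})-\Psi_\Theta(y^\delta)\|_2\to0$. (A4) For every $\delta$, $y^\delta$ and all $p,q\in P$: $w_{\Psi^\delta_\Theta}(p,q)>0$ if and only if $w_{x_0}(p,q)>0$. Consequently all $\Delta_{\Psi^\delta_\Theta}$ and $\Delta_{x_0}$ have the same kernel, denoted $V$. (A5) $\ker(K)\cap V=\{0\}$. (A6) $h_{\mathrm i}$ is Lipschitz and, for every fixed $p\in P$, the map $x\mapsto\mu_x(p)$ is Lipschitz. *)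

theory Defs
  imports "HOL-Analysis.Analysis"
begin

text \<open>
  The node set \<open>P\<close> is a finite type \<open>'p\<close>, so that \<open>X = C(P)\<close> is \<open>real ^ 'p\<close>, with
  \<open>n = CARD('p)\<close> and \<open>x(p)\<close> written \<open>x $ p\<close>. The type class \<open>metric_space\<close> plays no
  role for \<open>'p\<close>: the distance on \<open>P\<close> is an explicit function \<open>dist_P\<close>.
\<close>

definition edge_weight ::
  "('p \<Rightarrow> 'p \<Rightarrow> real) \<Rightarrow> (real \<Rightarrow> real) \<Rightarrow> (real \<Rightarrow> real) \<Rightarrow> real ^ 'p \<Rightarrow> 'p \<Rightarrow> 'p \<Rightarrow> real"
  where "edge_weight dist_P h_d h_i x p q = h_d (dist_P p q) * h_i \<bar>x $ p - x $ q\<bar>"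

definition graph_laplacian ::
  "('p \<Rightarrow> 'p \<Rightarrow> real) \<Rightarrow> (real \<Rightarrow> real) \<Rightarrow> (real \<Rightarrow> real) \<Rightarrow> (real ^ 'p \<Rightarrow> 'p \<Rightarrow> real)
    \<Rightarrow> real ^ 'p \<Rightarrow> real ^ 'p \<Rightarrow> real ^ 'p::finite"
  where "graph_laplacian dist_P h_d h_i \<mu> x u =
    (\<chi> p. 1 / \<mu> x p * (\<Sum>q\<in>UNIV. edge_weight dist_P h_d h_i x p q * (u $ p - u $ q)))"

definition l1_norm :: "real ^ 'p::finite \<Rightarrow> real"
  where "l1_norm u = (\<Sum>p\<in>UNIV. \<bar>u $ p\<bar>)"

definition reconstruction ::
  "('t \<Rightarrow> 'y \<Rightarrow> 'x) \<Rightarrow> (real \<Rightarrow> 'y \<Rightarrow> 't) \<Rightarrow> real \<Rightarrow> 'y \<Rightarrow> 'x"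
  where "reconstruction \<Psi> \<Theta> \<delta> y = \<Psi> (\<Theta> \<delta> y) y"

definition tikhonov ::
  "(real ^ 'p \<Rightarrow> real ^ 'm) \<Rightarrow> real \<Rightarrow> (real ^ 'p \<Rightarrow> real ^ 'p) \<Rightarrow> real ^ 'm \<Rightarrow> real ^ 'p::finite \<Rightarrow> real"
  where "tikhonov K \<alpha> L y x = 1 / 2 * (norm (K x - y))\<^sup>2 + \<alpha> * l1_norm (L x)"

definition argmin_set :: "('x \<Rightarrow> real) \<Rightarrow> 'x set"
  where "argmin_set F = {x. is_arg_min F (\<lambda>_. True) x}"

end

theory Submission
  imports Defs
begin

text \<open>
  The numbers \<open>s\<^sub>k = 1 / (1 + norm x\<^sub>k)\<close> and the vectors \<open>s\<^sub>k x\<^sub>k\<close> are bounded, so along a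
  subsequence they converge to some \<open>s\<close> and \<open>v\<close> with \<open>s + norm v = 1\<close>. If \<open>s = 0\<close>, then multiplying
  the bounds on the two terms of the objective at the minimizers by \<open>s\<^sub>k\<close> shows that \<open>v\<close> is
  annihilated by \<open>K\<close> and by the limiting Laplacian; but the kernel of a graph Laplacian depends only
  on which edge weights are positive, so (A4) and (A5) give \<open>v = 0\<close>, contradicting
  \<open>norm v = 1\<close>. Hence \<open>s > 0\<close> and \<open>x\<^sub>k\<close> converges along the subsequence to \<open>v / s\<close>. Its
  minimality follows by passing to the limit in the inequalities expressing minimality of \<open>x\<^sub>k\<close>.
\<close>

section \<open>The l1 norm and membership in an argmin set\<close>

lemma l1_norm_nonneg: "0 \<le> l1_norm u"
  by (simp add: l1_norm_def sum_nonneg)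

lemma l1_norm_scaleR: "l1_norm (c *\<^sub>R u) = \<bar>c\<bar> * l1_norm u"
  by (simp add: l1_norm_def abs_mult sum_distrib_left)

lemma norm_le_l1_norm: "norm u \<le> l1_norm u"
  unfolding l1_norm_def by (rule norm_le_l1_cart)

lemma tendsto_l1_norm:
  assumes "(f \<longlongrightarrow> u) F"
  shows "((\<lambda>k. l1_norm (f k)) \<longlongrightarrow> l1_norm u) F"
  unfolding l1_norm_def using assms by (intro tendsto_intros)

lemma mem_argmin_set_iff: "x \<in> argmin_set F \<longleftrightarrow> (\<forall>u. F x \<le> F u)"
  by (auto simp: argmin_set_def is_arg_min_def not_less)

section \<open>Graph Laplacians: linearity, kernel and joint continuity\<close>

lemma edge_weight_commute:
  assumes "\<And>p q. d p q = d q p"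
  shows "edge_weight d h_d h_i x p q = edge_weight d h_d h_i x q p"
  using assms by (simp add: edge_weight_def abs_minus_commute)

lemma graph_laplacian_linear: "linear (graph_laplacian d h_d h_i \<mu> x)"
proof (rule linearI)
  show "graph_laplacian d h_d h_i \<mu> x (u + v)
      = graph_laplacian d h_d h_i \<mu> x u + graph_laplacian d h_d h_i \<mu> x v" for u v
    by (simp add: graph_laplacian_def vec_eq_iff sum.distrib[symmetric] distrib_left[symmetric]
        add_divide_distrib[symmetric])
       (simp add: algebra_simps)
  show "graph_laplacian d h_d h_i \<mu> x (c *\<^sub>R u) = c *\<^sub>R graph_laplacian d h_d h_i \<mu> x u" for c u
    by (simp add: graph_laplacian_def vec_eq_iff sum_distrib_left algebra_simps)
qed

text \<open>
  One direction is the summation by parts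
  \<open>(\<Sum>p. \<mu> p * u p * \<Delta>u p) = 1/2 * (\<Sum>p q. w p q * (u p - u q)\<^sup>2)\<close>.
\<close>
lemma graph_laplacian_eq_0_iff:
  fixes d :: "'p::finite \<Rightarrow> 'p \<Rightarrow> real"
  assumes sym: "\<And>p q. d p q = d q p"
    and hd: "\<And>t. h_d t \<ge> 0" and hi: "\<And>t. h_i t \<ge> 0"
    and mu: "\<And>p. \<mu> x p > 0"
  shows "graph_laplacian d h_d h_i \<mu> x u = 0 \<longleftrightarrow>
    (\<forall>p q. edge_weight d h_d h_i x p q > 0 \<longrightarrow> u $ p = u $ q)"
proof -
  define w where "w = edge_weight d h_d h_i x"
  have w_nonneg: "w p q \<ge> 0" for p q
    by (simp add: w_def edge_weight_def hd hi)
  have w_sym: "w p q = w q p" for p q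
    unfolding w_def by (rule edge_weight_commute) (rule sym)
  have lap: "graph_laplacian d h_d h_i \<mu> x u = 0 \<longleftrightarrow> (\<forall>p. (\<Sum>q\<in>UNIV. w p q * (u $ p - u $ q)) = 0)"
    using mu by (auto simp: graph_laplacian_def vec_eq_iff w_def less_le)
  have "\<forall>p q. w p q > 0 \<longrightarrow> u $ p = u $ q" if harm: "\<forall>p. (\<Sum>q\<in>UNIV. w p q * (u $ p - u $ q)) = 0"
  proof -
    have S: "(\<Sum>p\<in>UNIV. \<Sum>q\<in>UNIV. w p q * (u $ p - u $ q) * u $ p) = 0"
      using harm by (simp add: sum_distrib_right[symmetric])
    \<comment> \<open>Exchanging the roles of \<open>p\<close> and \<open>q\<close> and using the
      symmetry of \<open>w\<close> turns this sum into minus the sum in \<open>S\<close>, so it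
      vanishes too. Subtracting it from \<open>S\<close> leaves the Dirichlet energy, whose terms
      are all nonnegative.\<close>
    have "(\<Sum>p\<in>UNIV. \<Sum>q\<in>UNIV. w p q * (u $ p - u $ q) * u $ q)
        = (\<Sum>q\<in>UNIV. \<Sum>p\<in>UNIV. w p q * (u $ p - u $ q) * u $ q)"
      by (rule sum.swap)
    also have "\<dots> = - (\<Sum>q\<in>UNIV. \<Sum>p\<in>UNIV. w q p * (u $ q - u $ p) * u $ q)"
      by (subst w_sym) (simp add: sum_negf[symmetric] algebra_simps)
    finally have "(\<Sum>p\<in>UNIV. \<Sum>q\<in>UNIV. w p q * (u $ p - u $ q) * u $ q) = 0"
      using S by simp
    with S have "(\<Sum>p\<in>UNIV. \<Sum>q\<in>UNIV. w p q * (u $ p - u $ q)\<^sup>2) = 0"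
      by (simp add: power2_eq_square right_diff_distrib mult.assoc[symmetric] sum_subtractf)
    then have "w p q * (u $ p - u $ q)\<^sup>2 = 0" for p q
      by (simp add: sum_nonneg_eq_0_iff sum_nonneg w_nonneg)
    then show ?thesis
      by (metis less_irrefl mult_eq_0_iff right_minus_eq zero_eq_power2)
  qed
  moreover have "(\<Sum>q\<in>UNIV. w p q * (u $ p - u $ q)) = 0" if "\<forall>p q. w p q > 0 \<longrightarrow> u $ p = u $ q" for p
  proof (intro sum.neutral ballI)
    show "w p q * (u $ p - u $ q) = 0" for q
      using that w_nonneg[of p q] by (cases "w p q = 0") auto
  qed
  ultimately show ?thesis
    unfolding lap w_def[symmetric] by blast
qed

text \<open>Each coordinate is a finite sum of products of convergent factors, divided by a node
  measure with nonzero limit. The base point and the argument move together because the Laplacian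
  and the vector it acts on both depend on \<open>k\<close>.\<close>

lemma tendsto_graph_laplacian:
  fixes d :: "'p::finite \<Rightarrow> 'p \<Rightarrow> real"
  assumes h_i: "continuous_on UNIV h_i" and \<mu>: "\<And>p. continuous_on UNIV (\<lambda>x. \<mu> x p)"
    and nz: "\<And>p. \<mu> z p \<noteq> 0"
    and f: "(f \<longlongrightarrow> z) F" and g: "(g \<longlongrightarrow> u) F"
  shows "((\<lambda>k. graph_laplacian d h_d h_i \<mu> (f k) (g k)) \<longlongrightarrow> graph_laplacian d h_d h_i \<mu> z u) F"
proof -
  have "((\<lambda>k. h_i \<bar>f k $ p - f k $ q\<bar>) \<longlongrightarrow> h_i \<bar>z $ p - z $ q\<bar>) F" for p q
    by (rule continuous_on_tendsto_compose[OF h_i]) (auto intro!: tendsto_intros f)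
  moreover have "((\<lambda>k. \<mu> (f k) p) \<longlongrightarrow> \<mu> z p) F" for p
    by (rule continuous_on_tendsto_compose[OF \<mu> f]) auto
  ultimately show ?thesis
    unfolding graph_laplacian_def edge_weight_def
    by (intro tendsto_intros f g nz)
qed

text \<open>Compactness and passage to the limit for abstract regularizers. \<open>L_lim\<close> is
  continuous convergence of the operators; it is stated along subsequences so that it still applies
  once \<open>r\<close> has been extracted.\<close>

lemma tikhonov_minimizers_subsequence:
  fixes K :: "real ^ 'p::finite \<Rightarrow> real ^ 'm::finite"
    and Ls :: "nat \<Rightarrow> real ^ 'p \<Rightarrow> real ^ 'p"
  assumes K: "linear K" and Ls: "\<And>k. linear (Ls k)" and \<alpha>: "\<alpha> > 0"
    and L_lim: "\<And>r us u. \<lbrakk>strict_mono r; us \<longlonglongrightarrow> u\<rbrakk> \<Longrightarrow> (\<lambda>k. Ls (r k) (us k)) \<longlonglongrightarrow> L u"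
    and ys: "ys \<longlonglongrightarrow> y"
    and inj: "\<And>u. \<lbrakk>K u = 0; L u = 0\<rbrakk> \<Longrightarrow> u = 0"
    and min: "\<And>k. xs k \<in> argmin_set (tikhonov K \<alpha> (Ls k) (ys k))"
  shows "\<exists>r x. strict_mono r \<and> (xs \<circ> r) \<longlonglongrightarrow> x \<and> x \<in> argmin_set (tikhonov K \<alpha> L y)"
proof -
  have K_lim: "(\<lambda>k. K (us k)) \<longlonglongrightarrow> K u" if "us \<longlonglongrightarrow> u" for us u
    using that by (rule bounded_linear.tendsto[OF linear_conv_bounded_linear[THEN iffD1, OF K]])
  \<comment> \<open>The summand 1 keeps the denominator positive even if \<open>xs k = 0\<close>,
    and gives the identity \<open>s_sum\<close>.\<close>
  define s where "s k = 1 / (1 + norm (xs k))" for k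
  have s_pos: "s k > 0" for k
    by (simp add: s_def add_pos_nonneg)
  have s_sum: "s k + norm (s k *\<^sub>R xs k) = 1" for k
    using s_pos[of k] by (simp add: s_def field_simps)
  \<comment> \<open>Working with pairs yields one subsequence for both components.\<close>
  have "bounded (range (\<lambda>k. (s k, s k *\<^sub>R xs k)))"
  proof (rule boundedI, clarify)
    show "norm (s k, s k *\<^sub>R xs k) \<le> 1" for k
      using norm_Pair_le[of "s k" "s k *\<^sub>R xs k"] s_sum[of k] s_pos[of k] by simp
  qed
  then obtain l r where r: "strict_mono r" and l: "((\<lambda>k. (s k, s k *\<^sub>R xs k)) \<circ> r) \<longlonglongrightarrow> l"
    using bounded_imp_convergent_subsequence by blast
  define t v where "t = fst l" and "v = snd l"
  have s_lim: "(\<lambda>k. s (r k)) \<longlonglongrightarrow> t" and v_lim: "(\<lambda>k. s (r k) *\<^sub>R xs (r k)) \<longlonglongrightarrow> v"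
    using tendsto_fst[OF l] tendsto_snd[OF l] by (simp_all add: t_def v_def)
  have yr_lim: "(\<lambda>k. ys (r k)) \<longlonglongrightarrow> y"
    using LIMSEQ_subseq_LIMSEQ[OF ys r] by (simp add: o_def)
  have "(\<lambda>k. s (r k) + norm (s (r k) *\<^sub>R xs (r k))) \<longlonglongrightarrow> t + norm v"
    by (intro tendsto_intros s_lim v_lim)
  then have tv: "t + norm v = 1"
    unfolding s_sum by (simp add: LIMSEQ_const_iff)
  have "t \<noteq> 0"
  proof
    assume t0: "t = 0"
    obtain B where B: "norm (ys k) \<le> B" for k
      using Bseq_def convergent_imp_Bseq[OF convergentI[OF ys]] by blast
    have bound: "tikhonov K \<alpha> (Ls k) (ys k) (xs k) \<le> B\<^sup>2 / 2" for k
    proof -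
      \<comment> \<open>The competitor 0 has no penalty, and its misfit is bounded uniformly in
        \<open>k\<close> because the data converge.\<close>
      have "tikhonov K \<alpha> (Ls k) (ys k) (xs k) \<le> tikhonov K \<alpha> (Ls k) (ys k) 0"
        using min[of k] by (simp add: mem_argmin_set_iff)
      also have "\<dots> = (norm (ys k))\<^sup>2 / 2"
        using linear_0[OF K] linear_0[OF Ls[of k]] by (simp add: tikhonov_def l1_norm_def)
      finally show ?thesis
        using power_mono[OF B[of k], of 2] by simp
    qed
    have fit: "norm (K (xs k) - ys k) \<le> B" for k
    proof (rule power2_le_imp_le)
      have "0 \<le> \<alpha> * l1_norm (Ls k (xs k))"
        using \<alpha> by (simp add: l1_norm_nonneg)
      then show "(norm (K (xs k) - ys k))\<^sup>2 \<le> B\<^sup>2"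
        using bound[of k] by (simp add: tikhonov_def)
      show "0 \<le> B"
        using B norm_ge_zero order_trans by blast
    qed
    have reg: "l1_norm (Ls k (xs k)) \<le> B\<^sup>2 / 2 / \<alpha>" for k
    proof -
      have "0 \<le> (norm (K (xs k) - ys k))\<^sup>2"
        by simp
      then have "\<alpha> * l1_norm (Ls k (xs k)) \<le> B\<^sup>2 / 2"
        using bound[of k] unfolding tikhonov_def by linarith
      then show ?thesis
        using \<alpha> by (simp add: field_simps)
    qed
    \<comment> \<open>The residuals stay bounded by \<open>fit\<close>, so scaling them by
      \<open>s (r k)\<close>, which tends to 0, makes them vanish.\<close>
    have "(\<lambda>k. K (s (r k) *\<^sub>R xs (r k)) - s (r k) *\<^sub>R ys (r k)) \<longlonglongrightarrow> 0"
    proof (rule Lim_null_comparison)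
      have "norm (K (s k *\<^sub>R xs k) - s k *\<^sub>R ys k) \<le> s k * B" for k
      proof -
        have "K (s k *\<^sub>R xs k) - s k *\<^sub>R ys k = s k *\<^sub>R (K (xs k) - ys k)"
          by (simp add: linear_cmul[OF K] scaleR_diff_right)
        then show ?thesis
          using fit[of k] s_pos[of k] by (simp add: mult_left_mono)
      qed
      then show "\<forall>\<^sub>F k in sequentially.
          norm (K (s (r k) *\<^sub>R xs (r k)) - s (r k) *\<^sub>R ys (r k)) \<le> s (r k) * B"
        by simp
      show "(\<lambda>k. s (r k) * B) \<longlonglongrightarrow> 0"
        using tendsto_mult_right[OF s_lim, of B] by (simp add: t0)
    qed
    moreover have "(\<lambda>k. K (s (r k) *\<^sub>R xs (r k)) - s (r k) *\<^sub>R ys (r k)) \<longlonglongrightarrow> K v - t *\<^sub>R y"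
      by (intro tendsto_intros K_lim s_lim v_lim yr_lim)
    ultimately have "K v - t *\<^sub>R y = 0"
      using LIMSEQ_unique by blast
    then have Kv: "K v = 0"
      by (simp add: t0)
    have "(\<lambda>k. Ls (r k) (s (r k) *\<^sub>R xs (r k))) \<longlonglongrightarrow> 0"
    proof (rule Lim_null_comparison)
      have "norm (Ls k (s k *\<^sub>R xs k)) \<le> s k * (B\<^sup>2 / 2 / \<alpha>)" for k
      proof -
        have "norm (Ls k (s k *\<^sub>R xs k)) \<le> l1_norm (Ls k (s k *\<^sub>R xs k))"
          by (rule norm_le_l1_norm)
        also have "\<dots> = s k * l1_norm (Ls k (xs k))"
          using s_pos[of k] by (simp add: linear_cmul[OF Ls] l1_norm_scaleR)
        also have "\<dots> \<le> s k * (B\<^sup>2 / 2 / \<alpha>)"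
          using s_pos[of k] reg[of k] by (intro mult_left_mono) auto
        finally show ?thesis .
      qed
      then show "\<forall>\<^sub>F k in sequentially. norm (Ls (r k) (s (r k) *\<^sub>R xs (r k))) \<le> s (r k) * (B\<^sup>2 / 2 / \<alpha>)"
        by (intro always_eventually allI)
      show "(\<lambda>k. s (r k) * (B\<^sup>2 / 2 / \<alpha>)) \<longlonglongrightarrow> 0"
        using tendsto_mult_right[OF s_lim, of "B\<^sup>2 / 2 / \<alpha>"] by (simp add: t0)
    qed
    \<comment> \<open>By \<open>L_lim\<close>, the same sequence also tends to
      \<open>L v\<close>.\<close>
    then have "L v = 0"
      using LIMSEQ_unique L_lim[OF r v_lim] by blast
    then have "v = 0"
      using inj Kv by blast
    then show False
      using tv t0 by simp
  qed
  \<comment> \<open>Undoing the scaling is possible in the limit because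
    \<open>t \<noteq> 0\<close>.\<close>
  define x where "x = v /\<^sub>R t"
  have "(\<lambda>k. (s (r k) *\<^sub>R xs (r k)) /\<^sub>R s (r k)) \<longlonglongrightarrow> x"
    unfolding x_def by (intro tendsto_intros s_lim v_lim \<open>t \<noteq> 0\<close>)
  moreover have "(s k *\<^sub>R xs k) /\<^sub>R s k = xs k" for k
    using s_pos[of k] by simp
  ultimately have x_lim: "(\<lambda>k. xs (r k)) \<longlonglongrightarrow> x"
    by simp
  have T_lim: "(\<lambda>k. tikhonov K \<alpha> (Ls (r k)) (ys (r k)) (us k)) \<longlonglongrightarrow> tikhonov K \<alpha> L y u"
    if "us \<longlonglongrightarrow> u" for us u
    unfolding tikhonov_def
    by (intro tendsto_intros tendsto_l1_norm K_lim L_lim r yr_lim that)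
  \<comment> \<open>The competitor \<open>u\<close> is kept fixed, as a constant sequence, while the
    operators and data vary on both sides.\<close>
  have "tikhonov K \<alpha> L y x \<le> tikhonov K \<alpha> L y u" for u
  proof (rule LIMSEQ_le[OF T_lim[OF x_lim] T_lim[OF tendsto_const[of u]]])
    show "\<exists>N. \<forall>k\<ge>N. tikhonov K \<alpha> (Ls (r k)) (ys (r k)) (xs (r k))
        \<le> tikhonov K \<alpha> (Ls (r k)) (ys (r k)) u"
      using min by (simp add: mem_argmin_set_iff)
  qed
  then show ?thesis
    using r x_lim by (auto simp: mem_argmin_set_iff o_def)
qed

theorem theorem3p16:
  fixes K :: "real ^ 'p::finite \<Rightarrow> real ^ 'm::finite"
    and y :: "real ^ 'm"
    and dist_P :: "'p \<Rightarrow> 'p \<Rightarrow> real"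
    and h_d h_i :: "real \<Rightarrow> real"
    and \<mu> :: "real ^ 'p \<Rightarrow> 'p \<Rightarrow> real"
    and Params :: "(real ^ 'l::finite) set"
    and \<Psi> :: "real ^ 'l \<Rightarrow> real ^ 'm \<Rightarrow> real ^ 'p"
    and \<Theta> :: "real \<Rightarrow> real ^ 'm \<Rightarrow> real ^ 'l"
    and x0 :: "real ^ 'p"
    and \<alpha> \<delta> :: real
    and y\<delta> :: "real ^ 'm"
    and \<delta>s :: "nat \<Rightarrow> real"
    and ys :: "nat \<Rightarrow> real ^ 'm"
    and xs :: "nat \<Rightarrow> real ^ 'p"
  assumes K_linear: "linear K"
    and distance: "Metric_space (UNIV :: 'p set) dist_P"
    and hd_nonneg: "\<And>t. h_d t \<ge> 0"
    and hd_zero: "h_d 0 = 0"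
    and hi_nonneg: "\<And>t. h_i t \<ge> 0"
    and mu_pos: "\<And>x p. \<mu> x p > 0"
    and Theta_in: "\<And>\<epsilon> z. \<epsilon> > 0 \<Longrightarrow> \<Theta> \<epsilon> z \<in> Params"
    and A1: "\<exists>xgt. K xgt = y"
    and A2: "\<And>\<epsilon> z. \<lbrakk>\<And>k. \<epsilon> k > 0; \<epsilon> \<longlonglongrightarrow> 0; \<And>k. norm (z k - y) \<le> \<epsilon> k\<rbrakk>
        \<Longrightarrow> (\<lambda>k. norm (reconstruction \<Psi> \<Theta> (\<epsilon> k) (z k) - x0)) \<longlonglongrightarrow> 0"
    and A3: "\<And>\<epsilon>0 z0 \<epsilon> z. \<lbrakk>\<epsilon>0 > 0; \<And>k. \<epsilon> k > 0; \<epsilon> \<longlonglongrightarrow> \<epsilon>0; z \<longlonglongrightarrow> z0\<rbrakk>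
        \<Longrightarrow> (\<lambda>k. \<Theta> (\<epsilon> k) (z k)) \<longlonglongrightarrow> \<Theta> \<epsilon>0 z0 \<and>
            (\<lambda>k. norm (reconstruction \<Psi> \<Theta> (\<epsilon> k) (z k) - reconstruction \<Psi> \<Theta> \<epsilon>0 z0)) \<longlonglongrightarrow> 0"
    and A4: "\<And>\<epsilon> z p q. \<epsilon> > 0 \<Longrightarrow>
        edge_weight dist_P h_d h_i (reconstruction \<Psi> \<Theta> \<epsilon> z) p q > 0 \<longleftrightarrow> edge_weight dist_P h_d h_i x0 p q > 0"
    and A5: "{u. K u = 0} \<inter> {u. graph_laplacian dist_P h_d h_i \<mu> x0 u = 0} = {0}"
    and A6_hi: "\<exists>L. L-lipschitz_on UNIV h_i"
    and A6_mu: "\<And>p. \<exists>L. L-lipschitz_on UNIV (\<lambda>x. \<mu> x p)"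
    and alpha_pos: "\<alpha> > 0"
    and delta_pos: "\<delta> > 0"
    and deltas_pos: "\<And>k. \<delta>s k > 0"
    and deltas_lim: "\<delta>s \<longlonglongrightarrow> \<delta>"
    and ys_lim: "ys \<longlonglongrightarrow> y\<delta>"
    and minimizers: "\<And>k. xs k \<in> argmin_set (tikhonov K \<alpha>
        (graph_laplacian dist_P h_d h_i \<mu> (reconstruction \<Psi> \<Theta> (\<delta>s k) (ys k))) (ys k))"
  shows "\<exists>(r :: nat \<Rightarrow> nat) x. strict_mono r \<and> (xs \<circ> r) \<longlonglongrightarrow> x \<and>
    x \<in> argmin_set (tikhonov K \<alpha> (graph_laplacian dist_P h_d h_i \<mu> (reconstruction \<Psi> \<Theta> \<delta> y\<delta>)) y\<delta>)"
proof (rule tikhonov_minimizers_subsequence[OF K_linear graph_laplacian_linear alpha_pos _ ys_lim _ minimizers])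
  let ?z = "reconstruction \<Psi> \<Theta> \<delta> y\<delta>"
  let ?zs = "\<lambda>k. reconstruction \<Psi> \<Theta> (\<delta>s k) (ys k)"
  \<comment> \<open>Stability of the reconstructor is what makes the Laplacians converge.\<close>
  have z_lim: "?zs \<longlonglongrightarrow> ?z"
    using A3[OF delta_pos deltas_pos deltas_lim ys_lim]
    by (simp add: LIM_zero_iff tendsto_norm_zero_iff)
  have hi_cont: "continuous_on UNIV h_i"
    using A6_hi lipschitz_on_continuous_on by blast
  have mu_cont: "continuous_on UNIV (\<lambda>x. \<mu> x p)" for p
    using A6_mu lipschitz_on_continuous_on by blast
  show "(\<lambda>k. graph_laplacian dist_P h_d h_i \<mu> (?zs (r k)) (us k))
      \<longlonglongrightarrow> graph_laplacian dist_P h_d h_i \<mu> ?z u"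
    if r: "strict_mono r" and us: "us \<longlonglongrightarrow> u" for r us u
  proof (rule tendsto_graph_laplacian[OF hi_cont mu_cont _ _ us])
    show "\<mu> ?z p \<noteq> 0" for p
      using mu_pos[of ?z p] by simp
    show "(\<lambda>k. ?zs (r k)) \<longlonglongrightarrow> ?z"
      using LIMSEQ_subseq_LIMSEQ[OF z_lim r] by (simp add: o_def)
  qed
  show "u = 0" if "K u = 0" and "graph_laplacian dist_P h_d h_i \<mu> ?z u = 0" for u
  proof -
    have sym: "dist_P p q = dist_P q p" for p q
      using Metric_space.commute[OF distance] by simp
    \<comment> \<open>Kept general in \<open>x\<close>, since it is applied both at
      \<open>?z\<close> and at \<open>x0\<close>: \<open>A4\<close> matches the positive edges of
      the two, which moves \<open>u\<close> into the kernel for which \<open>A5\<close> is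
      stated.\<close>
    have kernel: "graph_laplacian dist_P h_d h_i \<mu> x u = 0 \<longleftrightarrow>
        (\<forall>p q. edge_weight dist_P h_d h_i x p q > 0 \<longrightarrow> u $ p = u $ q)" for x
      by (rule graph_laplacian_eq_0_iff) (fact sym hd_nonneg hi_nonneg mu_pos)+
    have "graph_laplacian dist_P h_d h_i \<mu> x0 u = 0"
      using that(2) by (simp add: kernel A4[OF delta_pos])
    then show ?thesis
      using that(1) A5 by blast
  qed
qed

end
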